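(* Let $(f_\ell)_{\ell\in\mathbb N}$ be an admissible sequence of weight functions (as defined in the context) and let $S\subseteq\mathbb N$ with complement $E=\mathbb N\setminus S$. Assume $1,2\in S$ and $3\in E$. Let $n\ge 5$ be an integer. Then for all sufficiently large $\ell$ (depending on $n$): $\Delta_{E,\ell}(n)>0$ if $n\equiv 0\pmod 2$, and $\Delta_{E,\ell}(n)<0$ if $n\equiv 1\pmod 2$.
   Context: $\mathbb N=\{1,2,3,\dots\}$. An admissible sequence of weight functions is a sequence $(f_\ell)_{\ell\in\mathbb N}$ of functions $f_\ell:\mathbb N\to\mathbb N$ with $f_\ell(1)=1$ for all $\ell$ and $f_1\equiv 1$, for which there exist real-valued functions $\Phi,\Psi$ on $\mathbb N$ such that: (1) $n^{\Phi(\ell)}\le f_\ell(n)\le n^{\Psi(\ell)}$ for all $\ell,n\in\mathbb N$; (2) there is a positive number $B$ independent of $\ell$ with $0\le\Psi(\ell)-\Phi(\ell)\le B$ for all $\ell$; (3) $\lim_{\ell\to\infty}\Phi(\ell)=\infty$. For $S\subseteq\mathbb N$ with $1\in S$ and $E=\mathbb N\setminus S$ (the exception set), the numbers $p_{E,\ell}(n)$ are defined by the formal power series identity $\sum_{n=0}^\infty p_{E,\ell}(n)q^n=\prod_{n\in S}(1-q^n)^{-f_\ell(n)}$, and $\Delta_{E,\ell}(n):=p_{E,\ell}(n)^2-p_{E,\ell}(n-1)\,p_{E,\ell}(n+1)$ for $n\ge1$. *)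

theory Defs
  imports "HOL-Analysis.Analysis"
begin

text \<open>The positive integers are the set \<open>{1..}\<close> of type \<open>nat set\<close>. The value \<open>f l n\<close> of a
  family of weight functions is meaningful only for \<open>l \<ge> 1\<close> and \<open>n \<ge> 1\<close>; nothing is required
  of it (nor used) elsewhere.\<close>

definition admissible :: "(nat \<Rightarrow> nat \<Rightarrow> nat) \<Rightarrow> bool" where
  "admissible f \<longleftrightarrow>
     (\<forall>l\<ge>1. \<forall>n\<ge>1. f l n \<ge> 1) \<and>
     (\<forall>l\<ge>1. f l 1 = 1) \<and>
     (\<forall>n\<ge>1. f 1 n = 1) \<and>
     (\<exists>\<Phi> \<Psi> :: nat \<Rightarrow> real.
        (\<forall>l\<ge>1. \<forall>n\<ge>1. real n powr \<Phi> l \<le> real (f l n) \<and> real (f l n) \<le> real n powr \<Psi> l) \<and>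
        (\<exists>B>0. \<forall>l\<ge>1. 0 \<le> \<Psi> l - \<Phi> l \<and> \<Psi> l - \<Phi> l \<le> B) \<and>
        filterlim \<Phi> at_top sequentially)"

text \<open>The factor at index \<open>k\<close> belongs to the positive integer \<open>Suc k\<close>. The exponent
  \<open>- f l (Suc k)\<close> is expressed by the inverse power series, and the infinite product is the
  limit in the usual (coefficientwise) topology on formal power series.\<close>

definition euler_factor :: "nat set \<Rightarrow> (nat \<Rightarrow> nat \<Rightarrow> nat) \<Rightarrow> nat \<Rightarrow> nat \<Rightarrow> real fps" where
  "euler_factor E f l k =
     (if Suc k \<in> {1..} - E then inverse ((1 - fps_X ^ Suc k) ^ f l (Suc k)) else 1)"

definition p_exc :: "nat set \<Rightarrow> (nat \<Rightarrow> nat \<Rightarrow> nat) \<Rightarrow> nat \<Rightarrow> nat \<Rightarrow> real" where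
  "p_exc E f l n = fps_nth (\<Prod>k. euler_factor E f l k) n"

definition Delta_exc :: "nat set \<Rightarrow> (nat \<Rightarrow> nat \<Rightarrow> nat) \<Rightarrow> nat \<Rightarrow> nat \<Rightarrow> real" where
  "Delta_exc E f l n = (p_exc E f l n)\<^sup>2 - p_exc E f l (n - 1) * p_exc E f l (n + 1)"

text \<open>The infinite product always converges, so that \<^const>\<open>p_exc\<close> is given by the intended identity.\<close>

lemma euler_factor_decomp: "\<exists>H. euler_factor E f l k = 1 + fps_X ^ Suc k * H"
proof (cases "Suc k \<in> E")
  case True
  then show ?thesis by (intro exI[of _ 0]) (simp add: euler_factor_def)
next
  case False
  define u :: "real fps" where "u = (1 - fps_X ^ Suc k) ^ f l (Suc k)"
  have u0: "fps_nth u 0 \<noteq> 0"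
    by (simp add: u_def fps_power_zeroth)
  have "(1 - fps_X ^ Suc k) - 1 dvd u - 1"
    unfolding u_def by (subst power_diff_1_eq) (rule dvd_triv_left)
  then obtain G where G: "u - 1 = ((1 - fps_X ^ Suc k) - 1) * G" by (rule dvdE)
  have "inverse u = 1 - inverse u * (u - 1)"
    using inverse_mult_eq_1[OF u0] by (simp add: right_diff_distrib)
  also have "\<dots> = 1 + fps_X ^ Suc k * (G * inverse u)"
    unfolding G by (simp add: mult_ac del: power_Suc)
  finally show ?thesis using False by (auto simp: euler_factor_def u_def)
qed

lemma euler_prod_nth:
  assumes "n \<le> N"
  shows "fps_nth (\<Prod>k\<le>N. euler_factor E f l k) n = fps_nth (\<Prod>k\<le>n. euler_factor E f l k) n"
  using assms
proof (induction N rule: dec_induct)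
  case (step N)
  obtain H where H: "euler_factor E f l (Suc N) = 1 + fps_X ^ Suc (Suc N) * H"
    using euler_factor_decomp by blast
  have "(\<Prod>k\<le>Suc N. euler_factor E f l k) =
          (\<Prod>k\<le>N. euler_factor E f l k) + fps_X ^ Suc (Suc N) * (H * (\<Prod>k\<le>N. euler_factor E f l k))"
    by (simp add: H distrib_left mult_ac del: power_Suc)
  then show ?case
    using step by (simp add: fps_X_power_mult_nth del: power_Suc prod.atMost_Suc)
qed simp

lemma euler_has_prod: "euler_factor E f l has_prod Abs_fps (p_exc E f l)"
proof -
  define P where "P = Abs_fps (\<lambda>n. fps_nth (\<Prod>k\<le>n. euler_factor E f l k) n)"
  have lim: "(\<lambda>N. \<Prod>k\<le>N. euler_factor E f l k) \<longlonglongrightarrow> P"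
  proof (rule tendsto_fpsI)
    fix n
    show "\<forall>\<^sub>F N in sequentially. fps_nth (\<Prod>k\<le>N. euler_factor E f l k) n = fps_nth P n"
      using eventually_ge_at_top[of n] by eventually_elim (unfold P_def fps_nth_Abs_fps, rule euler_prod_nth)
  qed
  obtain H where "euler_factor E f l 0 = 1 + fps_X ^ Suc 0 * H"
    using euler_factor_decomp by blast
  then have "fps_nth P 0 = 1" by (simp add: P_def)
  then have "P \<noteq> 0" by auto
  with lim have hp: "euler_factor E f l has_prod P"
    by (simp add: has_prod_def raw_has_prod_def)
  have "P = (\<Prod>k. euler_factor E f l k)" by (rule has_prod_unique[OF hp])
  then have "Abs_fps (p_exc E f l) = P" by (simp add: fps_eq_iff p_exc_def)
  with hp show ?thesis by simp
qed

end

theory Submission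
  imports Defs "HOL-Library.Landau_Symbols"
begin

text \<open>Since \<open>f l k\<close> grows like \<open>k powr \<Phi> l\<close> up to factors that do not depend on \<open>l\<close>, the number
  \<open>p n\<close> grows like \<open>M n powr \<Phi> l\<close>, where \<open>M n\<close> is the largest product of the parts of a partition of
  \<open>n\<close> into elements of \<open>S\<close>. As \<open>3\<close> is not available, \<open>M n = 2 ^ (n div 2)\<close> for even \<open>n\<close> while for
  odd \<open>n \<ge> 5\<close> the best one can hope for is \<open>5 * 2 ^ ((n - 5) div 2)\<close>, from the partition \<open>5 + 2 + \<dots> + 2\<close>.
  The signs follow from \<open>25 < 32\<close>.\<close>

text \<open>The product bound \<open>M\<close>, extended below 5 by its own formula, with the value \<open>5 / 2\<close> at 3: it stays
  supermultiplicative and is at least \<open>k\<close> at every \<open>k \<noteq> 3\<close>, which is all that the upper bound needs.\<close>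

definition parity_weight :: "nat \<Rightarrow> real" where
  "parity_weight n = (if even n then 2 ^ (n div 2) else 5 / 4 * 2 ^ (n div 2))"

section \<open>Inequalities for the weight function\<close>

lemma parity_weight_ge_1: "parity_weight n \<ge> 1"
proof -
  have "(1::real) \<le> 2 ^ (n div 2)" by simp
  then show ?thesis unfolding parity_weight_def by (auto simp del: one_le_power)
qed

lemma parity_weight_pos: "parity_weight n > 0"
  using parity_weight_ge_1[of n] by linarith

text \<open>If \<open>a\<close> or \<open>b\<close> is even, the two sides agree. If both are odd,
  the halves carry an extra unit, which gives a factor 2 on the right against
  \<open>(5/4)^2 = 25/16\<close> on the left.\<close>

lemma parity_weight_mult_le: "parity_weight a * parity_weight b \<le> parity_weight (a + b)"
proof -
  obtain i j where "a = 2 * i \<or> a = 2 * i + 1" "b = 2 * j \<or> b = 2 * j + 1"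
    by (meson oddE evenE)
  moreover have "Suc (Suc (2 * i + 2 * j)) div 2 = Suc (i + j)" by simp
  ultimately show ?thesis
    by (auto simp: parity_weight_def power_add)
qed

lemma parity_weight_power_le: "parity_weight k ^ m \<le> parity_weight (k * m)"
proof (induction m)
  case 0
  then show ?case by (simp add: parity_weight_def)
next
  case (Suc m)
  have "parity_weight k ^ Suc m \<le> parity_weight k * parity_weight (k * m)"
    using Suc parity_weight_pos[of k] by simp
  also have "\<dots> \<le> parity_weight (k * Suc m)"
    using parity_weight_mult_le[of k "k * m"] by simp
  finally show ?case .
qed

text \<open>Equality holds at 2, 4 and 5. From there on, a step of 2 in \<open>k\<close> doubles the
  weight, which outpaces the growth of \<open>k\<close>. At 3 the weight is only \<open>5/2\<close>;
  this is where excluding the part 3 matters.\<close>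

lemma le_parity_weight:
  assumes "k \<noteq> 3"
  shows "real k \<le> parity_weight k"
proof (cases "even k")
  case True
  then obtain i where k: "k = 2 * i" by blast
  have "2 * real i \<le> 2 ^ i"
  proof (induction i)
    case (Suc i)
    have "(2::real) \<le> 2 ^ Suc i" by simp
    then show ?case using Suc by (cases "i = 0") auto
  qed simp
  then show ?thesis by (simp add: parity_weight_def k)
next
  case False
  then obtain i where k: "k = 2 * i + 1" by (blast elim: oddE)
  have "2 * real i + 1 \<le> 5 / 4 * 2 ^ i" if "i \<ge> 2"
    using that
  proof (induction i rule: dec_induct)
    case (step i)
    then show ?case by simp
  qed simp
  moreover have "i = 0 \<or> i \<ge> 2" using assms k by auto
  ultimately show ?thesis by (auto simp: parity_weight_def k)
qed

text \<open>In both cases the smaller side is \<open>25/32\<close> of the larger: the two odd-index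
  weights contribute \<open>(5/4)^2\<close>, and rounding in \<open>div 2\<close> contributes a
  factor 2 on the side of the even indices.\<close>

lemma parity_weight_neighbours:
  assumes "n \<ge> 1"
  shows "even n \<Longrightarrow> parity_weight (n - 1) * parity_weight (n + 1) < parity_weight n ^ 2"
    and "odd n \<Longrightarrow> parity_weight n ^ 2 < parity_weight (n - 1) * parity_weight (n + 1)"
proof -
  assume "even n"
  then obtain i where "n = 2 * Suc i" using assms
    by (metis evenE mult_0_right not0_implies_Suc not_one_le_zero)
  then show "parity_weight (n - 1) * parity_weight (n + 1) < parity_weight n ^ 2"
    by (simp add: parity_weight_def power2_eq_square)
next
  assume "odd n"
  then obtain i where "n = 2 * i + 1" by (blast elim: oddE)
  then show "parity_weight n ^ 2 < parity_weight (n - 1) * parity_weight (n + 1)"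
    by (simp add: parity_weight_def power2_eq_square)
qed

section \<open>Coefficients of a single factor\<close>

lemma fps_nth_inverse_one_minus_X_power:
  assumes "k > 0" and "F > 0"
  shows "fps_nth (inverse ((1 - fps_X ^ k :: real fps) ^ F)) n =
           (if k dvd n then real ((F + n div k - 1) choose (n div k)) else 0)"
proof -
  define A where "A = inverse ((1 - fps_X :: real fps) ^ F)"
  have X0: "fps_nth (fps_X ^ k :: real fps) 0 = 0" using assms by simp
  \<comment> \<open>Substituting \<open>X^k\<close> for \<open>X\<close> reduces the claim to the
    negative binomial series of \<open>(1 - X)^(-F)\<close>.\<close>
  have "fps_compose A (fps_X ^ k) = inverse (fps_compose ((1 - fps_X) ^ F) (fps_X ^ k))"
    unfolding A_def by (rule fps_inverse_compose) (use X0 in \<open>auto simp: fps_power_zeroth\<close>)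
  also have "fps_compose ((1 - fps_X) ^ F) (fps_X ^ k :: real fps) = (1 - fps_X ^ k) ^ F"
    using X0 by (simp only: fps_compose_power[symmetric] fps_compose_sub_distrib fps_compose_1
        fps_X_fps_compose_startby0)
  finally have "inverse ((1 - fps_X ^ k :: real fps) ^ F) = fps_compose A (fps_X ^ k)" by simp
  then have "fps_nth (inverse ((1 - fps_X ^ k :: real fps) ^ F)) n =
               (\<Sum>i=0..n. if n = k * i then fps_nth A i else 0)"
    by (auto simp: fps_compose_nth simp flip: power_mult intro!: sum.cong)
  also have "\<dots> = (\<Sum>i=0..n. if i = n div k \<and> k dvd n then fps_nth A i else 0)"
    using assms(1) by (intro sum.cong) auto
  also have "\<dots> = (if k dvd n then fps_nth A (n div k) else 0)"
    by auto
  also have "fps_nth A (n div k) = real ((F + n div k - 1) choose (n div k))"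
    using one_minus_const_fps_X_neg_power'[OF assms(2), of "1::real"] by (simp add: A_def)
  finally show ?thesis .
qed

text \<open>There are at most as many multisets of size \<open>m\<close> over \<open>F\<close>
  elements as sequences of length \<open>m\<close>. In the induction the ratio of consecutive values
  is \<open>(F + m) / (m + 1)\<close>, at most \<open>F\<close> because \<open>F\<close> is at least
  1.\<close>

lemma multichoose_le_power:
  assumes "F > 0"
  shows "(F + m - 1) choose m \<le> F ^ m"
proof (induction m)
  case (Suc m)
  obtain G where F: "F = Suc G" using assms by (metis gr0_implies_Suc)
  have "Suc m * ((F + Suc m - 1) choose Suc m) = (F + m) * ((F + m - 1) choose m)"
    using Suc_times_binomial[of m "G + m"] by (simp add: F)
  also have "\<dots> \<le> (Suc m * F) * F ^ m"
    by (rule mult_mono) (use Suc in \<open>auto simp: F\<close>)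
  finally have "Suc m * ((F + Suc m - 1) choose Suc m) \<le> Suc m * F ^ Suc m"
    by (simp only: power_Suc mult.assoc)
  then show ?case by (subst (asm) mult_le_cancel1) simp
qed simp

section \<open>Coefficients of the infinite product\<close>

lemma p_exc_eq_finite_prod: "p_exc E f l n = fps_nth (\<Prod>k\<le>n. euler_factor E f l k) n"
proof -
  have "(\<lambda>N. \<Prod>k\<le>N. euler_factor E f l k) \<longlonglongrightarrow> Abs_fps (p_exc E f l)"
    using has_prod_imp_tendsto[OF euler_has_prod] .
  \<comment> \<open>Convergence of power series means that each coefficient is eventually
    constant.\<close>
  then have "\<forall>\<^sub>F N in sequentially. fps_nth (\<Prod>k\<le>N. euler_factor E f l k) n = p_exc E f l n"
    by (auto simp: tendsto_fps_iff)
  moreover have "\<forall>\<^sub>F N in sequentially. N \<ge> n" by (rule eventually_ge_at_top)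
  ultimately have "\<forall>\<^sub>F N in sequentially. p_exc E f l n = fps_nth (\<Prod>k\<le>n. euler_factor E f l k) n"
    by eventually_elim (metis euler_prod_nth)
  then show ?thesis by simp
qed

lemma euler_factor_nth_0: "fps_nth (euler_factor E f l k) 0 = 1"
  by (simp add: euler_factor_def fps_power_zeroth)

lemma euler_factor_nonneg:
  assumes "\<And>k. k \<ge> 1 \<Longrightarrow> f l k \<ge> 1"
  shows "fps_nth (euler_factor E f l k) n \<ge> 0"
  using assms[of "Suc k"]
  by (simp add: euler_factor_def fps_nth_inverse_one_minus_X_power del: power_Suc)

lemma fps_prod_nonneg:
  fixes P :: "'a \<Rightarrow> real fps"
  assumes "\<And>k n. k \<in> A \<Longrightarrow> fps_nth (P k) n \<ge> 0"
  shows "fps_nth (\<Prod>k\<in>A. P k) n \<ge> 0"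
  using assms
proof (induction A arbitrary: n rule: infinite_finite_induct)
  case (insert x A)
  then show ?case by (simp add: fps_mult_nth sum_nonneg)
qed auto

lemma fps_nth_0_prod: "fps_nth (\<Prod>k\<in>A. P k) 0 = (\<Prod>k\<in>A. fps_nth (P k) 0)"
  by (induction A rule: infinite_finite_induct) auto

text \<open>In the Cauchy product of \<open>P j\<close> with the remaining factors, all terms are
  nonnegative, and the one pairing coefficient \<open>n\<close> of \<open>P j\<close> with the
  constant term 1 of the rest is the left-hand side.\<close>

lemma fps_nth_factor_le_prod:
  fixes P :: "'a \<Rightarrow> real fps"
  assumes "finite A" "j \<in> A"
    and nonneg: "\<And>k n. k \<in> A \<Longrightarrow> fps_nth (P k) n \<ge> 0"
    and one: "\<And>k. k \<in> A \<Longrightarrow> fps_nth (P k) 0 = 1"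
  shows "fps_nth (P j) n \<le> fps_nth (\<Prod>k\<in>A. P k) n"
proof -
  define Q where "Q = (\<Prod>k\<in>A - {j}. P k)"
  have "fps_nth Q 0 = (\<Prod>k\<in>A - {j}. fps_nth (P k) 0)"
    unfolding Q_def by (rule fps_nth_0_prod)
  then have Q0: "fps_nth Q 0 = 1" using one by simp
  have Q: "fps_nth Q i \<ge> 0" for i
    unfolding Q_def by (rule fps_prod_nonneg) (use nonneg in auto)
  have "fps_nth (P j) n * fps_nth Q (n - n) \<le> (\<Sum>i=0..n. fps_nth (P j) i * fps_nth Q (n - i))"
    by (rule member_le_sum) (use Q nonneg assms(2) in auto)
  then show ?thesis
    using assms(1,2) by (simp add: Q0 prod.remove[of A j] fps_mult_nth flip: Q_def)
qed

section \<open>Asymptotic upper bounds\<close>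

lemma powr_smallo_powr:
  fixes x y :: real
  assumes "0 < x" "x < y" "filterlim \<Phi> at_top F"
  shows "(\<lambda>l. x powr \<Phi> l) \<in> o[F](\<lambda>l. y powr \<Phi> l)"
proof (rule smalloI_tendsto)
  \<comment> \<open>The quotient of the two powers is \<open>exp (ln (x / y) * \<Phi> l)\<close>,
    whose exponent tends to minus infinity.\<close>
  have "ln (x / y) < 0" using assms by simp
  then have "filterlim (\<lambda>l. ln (x / y) * \<Phi> l) at_bot F"
    using assms(3) filterlim_tendsto_neg_mult_at_bot[OF tendsto_const] by blast
  then have "((\<lambda>l. exp (ln (x / y) * \<Phi> l)) \<longlongrightarrow> 0) F"
    by (rule filterlim_compose[OF exp_at_bot])
  then show "((\<lambda>l. x powr \<Phi> l / y powr \<Phi> l) \<longlongrightarrow> 0) F"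
    using assms by (simp add: powr_def ln_div algebra_simps exp_diff)
qed (use assms in auto)

lemma powr_bigo_powr:
  fixes x y :: real
  assumes "0 \<le> x" "x \<le> y" "\<forall>\<^sub>F l in F. \<Phi> l \<ge> 0"
  shows "(\<lambda>l. x powr \<Phi> l) \<in> O[F](\<lambda>l. y powr \<Phi> l)"
proof (rule bigoI[of _ 1])
  show "\<forall>\<^sub>F l in F. norm (x powr \<Phi> l) \<le> 1 * norm (y powr \<Phi> l)"
    using assms(3) by eventually_elim (use assms in \<open>auto intro: powr_mono2\<close>)
qed

lemma bigo_power:
  fixes g h :: "'a \<Rightarrow> real"
  assumes "g \<in> O[F](h)"
  shows "(\<lambda>x. g x ^ m) \<in> O[F](\<lambda>x. h x ^ m)"
  by (induction m) (auto intro: landau_o.big.mult assms)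

text \<open>The implied constant may depend on \<open>n\<close> but not on \<open>l\<close>.
  Supermultiplicativity of the weight makes this property stable under finite products, so it can be
  checked factor by factor.\<close>

definition weight_bounded :: "(nat \<Rightarrow> real) \<Rightarrow> (nat \<Rightarrow> real fps) \<Rightarrow> bool" where
  "weight_bounded \<Phi> P \<longleftrightarrow> (\<forall>n. (\<lambda>l. fps_nth (P l) n) \<in> O(\<lambda>l. parity_weight n powr \<Phi> l))"

lemma weight_bounded_one: "weight_bounded \<Phi> (\<lambda>_. 1)"
  unfolding weight_bounded_def by (auto simp: parity_weight_def)

lemma weight_bounded_mult:
  assumes "weight_bounded \<Phi> P" "weight_bounded \<Phi> Q" "\<forall>\<^sub>F l in sequentially. \<Phi> l \<ge> 0"
  shows "weight_bounded \<Phi> (\<lambda>l. P l * Q l)"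
  unfolding weight_bounded_def fps_mult_nth
proof (intro allI big_sum_in_bigo)
  fix n i :: nat assume "i \<in> {0..n}"
  have "(\<lambda>l. fps_nth (P l) i * fps_nth (Q l) (n - i)) \<in>
          O(\<lambda>l. parity_weight i powr \<Phi> l * parity_weight (n - i) powr \<Phi> l)"
    using assms by (intro landau_o.big.mult) (auto simp: weight_bounded_def)
  also have "(\<lambda>l. parity_weight i powr \<Phi> l * parity_weight (n - i) powr \<Phi> l) =
               (\<lambda>l. (parity_weight i * parity_weight (n - i)) powr \<Phi> l)"
    by (intro ext powr_mult[symmetric])
  also have "\<dots> \<in> O(\<lambda>l. parity_weight n powr \<Phi> l)"
    using parity_weight_mult_le[of i "n - i"] \<open>i \<in> {0..n}\<close> parity_weight_pos assms(3)
    by (intro powr_bigo_powr) (auto intro: less_imp_le)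
  finally show "(\<lambda>l. fps_nth (P l) i * fps_nth (Q l) (n - i)) \<in> O(\<lambda>l. parity_weight n powr \<Phi> l)" .
qed

lemma weight_bounded_prod:
  assumes "\<And>k. k \<in> A \<Longrightarrow> weight_bounded \<Phi> (P k)" "\<forall>\<^sub>F l in sequentially. \<Phi> l \<ge> 0"
  shows "weight_bounded \<Phi> (\<lambda>l. \<Prod>k\<in>A. P k l)"
  using assms(1)
  by (induction A rule: infinite_finite_induct)
     (auto intro: weight_bounded_one weight_bounded_mult assms(2))

text \<open>With \<open>j = Suc k\<close>, the coefficient at \<open>j * m\<close> is at most
  \<open>(f l j)^m\<close>, hence of order \<open>(j^m) powr \<Phi> l\<close>, and
  \<open>j^m \<le> parity_weight j ^ m \<le> parity_weight (j * m)\<close>. The part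
  \<open>j = 3\<close>, where the first inequality can fail, lies in \<open>E\<close>, so its factor
  is 1.\<close>

lemma weight_bounded_euler_factor:
  assumes ge1: "\<And>l k. l \<ge> 1 \<Longrightarrow> k \<ge> 1 \<Longrightarrow> f l k \<ge> 1"
    and upper: "\<And>k. k \<ge> 1 \<Longrightarrow> (\<lambda>l. real (f l k)) \<in> O(\<lambda>l. real k powr \<Phi> l)"
    and "3 \<in> E" and \<Phi>: "\<forall>\<^sub>F l in sequentially. \<Phi> l \<ge> 0"
  shows "weight_bounded \<Phi> (\<lambda>l. euler_factor E f l k)"
proof (cases "Suc k \<in> E")
  case True
  then show ?thesis using weight_bounded_one by (simp add: euler_factor_def)
next
  case False
  then have "Suc k \<noteq> 3" using \<open>3 \<in> E\<close> by auto
  show ?thesis unfolding weight_bounded_def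
  proof
    fix n
    show "(\<lambda>l. fps_nth (euler_factor E f l k) n) \<in> O(\<lambda>l. parity_weight n powr \<Phi> l)"
    proof (cases "Suc k dvd n")
      case dvd: True
      then obtain m where n: "n = Suc k * m" by blast
      have "(\<lambda>l. fps_nth (euler_factor E f l k) n) \<in> O(\<lambda>l. real (f l (Suc k)) ^ m)"
      proof (rule bigoI[of _ 1])
        show "\<forall>\<^sub>F l in sequentially. norm (fps_nth (euler_factor E f l k) n)
                \<le> 1 * norm (real (f l (Suc k)) ^ m)"
          using eventually_ge_at_top[of 1]
        proof eventually_elim
          case (elim l)
          then have F: "f l (Suc k) > 0" using ge1[of l "Suc k"] by simp
          have "n div Suc k = m" unfolding n by (rule nonzero_mult_div_cancel_left) simp
          then have "fps_nth (euler_factor E f l k) n = real ((f l (Suc k) + m - 1) choose m)"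
            using False dvd fps_nth_inverse_one_minus_X_power[OF _ F, of "Suc k" n]
            by (simp add: euler_factor_def del: power_Suc)
          then show ?case
            using of_nat_mono[OF multichoose_le_power[OF F, of m], where ?'a = real] by simp
        qed
      qed
      also have "(\<lambda>l. real (f l (Suc k)) ^ m) \<in> O(\<lambda>l. (real (Suc k) powr \<Phi> l) ^ m)"
        by (intro bigo_power upper) simp
      also have "(\<lambda>l. (real (Suc k) powr \<Phi> l) ^ m) = (\<lambda>l. (real (Suc k) ^ m) powr \<Phi> l)"
        by (intro ext) (simp add: powr_powr mult.commute flip: powr_realpow)
      also have "\<dots> \<in> O(\<lambda>l. parity_weight n powr \<Phi> l)"
      proof (rule powr_bigo_powr[OF _ _ \<Phi>])
        have "real (Suc k) ^ m \<le> parity_weight (Suc k) ^ m"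
          by (intro power_mono le_parity_weight \<open>Suc k \<noteq> 3\<close>) simp
        also have "\<dots> \<le> parity_weight n"
          unfolding n by (rule parity_weight_power_le)
        finally show "real (Suc k) ^ m \<le> parity_weight n" .
      qed simp
      finally show ?thesis .
    next
      case ndvd: False
      have "\<forall>\<^sub>F l in sequentially. fps_nth (euler_factor E f l k) n = 0"
        using eventually_ge_at_top[of 1]
      proof eventually_elim
        case (elim l)
        then have F: "f l (Suc k) > 0" using ge1[of l "Suc k"] by simp
        then show ?case
          using False ndvd fps_nth_inverse_one_minus_X_power[OF _ F, of "Suc k" n]
          by (simp add: euler_factor_def del: power_Suc)
      qed
      then show ?thesis by (subst landau_o.big.in_cong[of _ "\<lambda>_. 0"]) auto
    qed
  qed
qed

section \<open>A lower bound at even indices\<close>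

lemma p_exc_even_lower:
  assumes ge1: "\<And>k. k \<ge> 1 \<Longrightarrow> f l k \<ge> 1" and "2 \<notin> E" and "m \<ge> 1"
  shows "(real (f l 2) / real m) ^ m \<le> p_exc E f l (2 * m)"
proof -
  have F: "f l 2 \<ge> 1" using ge1 by simp
  \<comment> \<open>Only partitions of \<open>2 * m\<close> into \<open>m\<close> twos are counted;
    the binomial coefficient that counts them is bounded below by \<open>(n/k)^k\<close>.\<close>
  have "(real (f l 2) / real m) ^ m \<le> (real (f l 2 + m - 1) / real m) ^ m"
    using F \<open>m \<ge> 1\<close> by (intro power_mono divide_right_mono) auto
  also have "\<dots> \<le> real ((f l 2 + m - 1) choose m)"
    by (rule binomial_ge_n_over_k_pow_k) (use F in auto)
  also have "\<dots> = fps_nth (euler_factor E f l 1) (2 * m)"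
  proof -
    \<comment> \<open>The factor with index 1 belongs to the part 2.\<close>
    have "Suc 1 = 2" by simp
    then show ?thesis
      using F \<open>2 \<notin> E\<close> fps_nth_inverse_one_minus_X_power[of 2 "f l 2" "2 * m"]
      by (simp only: euler_factor_def) simp
  qed
  also have "\<dots> \<le> p_exc E f l (2 * m)"
    unfolding p_exc_eq_finite_prod
    by (rule fps_nth_factor_le_prod)
       (use \<open>m \<ge> 1\<close> ge1 euler_factor_nonneg euler_factor_nth_0 in auto)
  finally show ?thesis .
qed

section \<open>Comparison of the growth rates\<close>

theorem theorem2p3:
  fixes f :: "nat \<Rightarrow> nat \<Rightarrow> nat" and S E :: "nat set" and n :: nat
  assumes "admissible f"
    and "S \<subseteq> {1..}" and "E = {1..} - S"
    and "1 \<in> S" and "2 \<in> S" and "3 \<in> E"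
    and "n \<ge> 5"
  shows "\<forall>\<^sub>F l in sequentially.
           (even n \<longrightarrow> Delta_exc E f l n > 0) \<and> (odd n \<longrightarrow> Delta_exc E f l n < 0)"
proof -
  have ge1: "\<And>l k. l \<ge> 1 \<Longrightarrow> k \<ge> 1 \<Longrightarrow> f l k \<ge> 1"
    using \<open>admissible f\<close> by (simp add: admissible_def)
  obtain \<Phi> \<Psi> :: "nat \<Rightarrow> real" and B where
    bounds: "\<forall>l\<ge>1. \<forall>k\<ge>1. real k powr \<Phi> l \<le> real (f l k) \<and> real (f l k) \<le> real k powr \<Psi> l" and
    diff: "\<forall>l\<ge>1. 0 \<le> \<Psi> l - \<Phi> l \<and> \<Psi> l - \<Phi> l \<le> B" and
    lim: "filterlim \<Phi> at_top sequentially"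
    using \<open>admissible f\<close> unfolding admissible_def by (elim conjE exE) (rule that)
  have B: "\<Psi> l \<le> B + \<Phi> l" if "l \<ge> 1" for l
    using diff that by (auto simp: algebra_simps)
  have \<Phi>: "\<forall>\<^sub>F l in sequentially. \<Phi> l \<ge> 0"
    using lim by (simp add: filterlim_at_top)
  have "2 \<notin> E" using assms by simp
  let ?w = parity_weight and ?p = "\<lambda>n l. p_exc E f l n"

  have f_bigo: "(\<lambda>l. real (f l k)) \<in> O(\<lambda>l. real k powr \<Phi> l)" if "k \<ge> 1" for k
  \<comment> \<open>Since \<open>\<Psi> l - \<Phi> l \<le> B\<close>, passing from
    \<open>\<Psi>\<close> to \<open>\<Phi>\<close> costs a factor \<open>k powr B\<close>
    independent of \<open>l\<close>.\<close>
  proof (rule bigoI[of _ "real k powr B"])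
    show "\<forall>\<^sub>F l in sequentially. norm (real (f l k)) \<le> real k powr B * norm (real k powr \<Phi> l)"
      using eventually_ge_at_top[of 1]
    proof eventually_elim
      case (elim l)
      have "real (f l k) \<le> real k powr \<Psi> l" using bounds elim that by simp
      also have "\<dots> \<le> real k powr (B + \<Phi> l)" using B[OF elim] that by (intro powr_mono) auto
      finally show ?case by (simp add: powr_add)
    qed
  qed
  have p_bigo: "?p i \<in> O(\<lambda>l. ?w i powr \<Phi> l)" for i
    using weight_bounded_prod[of "{..i}" \<Phi> "\<lambda>k l. euler_factor E f l k"]
      weight_bounded_euler_factor[OF ge1 f_bigo \<open>3 \<in> E\<close> \<Phi>] \<Phi>
    by (simp add: weight_bounded_def p_exc_eq_finite_prod)

  \<comment> \<open>The constant clears the denominator \<open>m^m\<close> in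
    \<open>(f l 2 / m)^m\<close>. Lower bounds at even indices serve both cases: at \<open>n\<close>
    for even \<open>n\<close>, at \<open>n - 1\<close> and \<open>n + 1\<close> for odd
    \<open>n\<close>.\<close>
  have p_lower: "\<forall>\<^sub>F l in sequentially. 0 < ?p i l \<and> ?w i powr \<Phi> l \<le> real (i div 2) ^ (i div 2) * ?p i l"
    if "even i" "i > 0" for i
    using eventually_ge_at_top[of 1]
  proof eventually_elim
    case (elim l)
    define m where "m = i div 2"
    have m: "i = 2 * m" "m \<ge> 1" using that by (auto simp: m_def)
    have "0 < (real (f l 2) / real m) ^ m" using m ge1[of l 2] elim by simp
    moreover have le: "(real (f l 2) / real m) ^ m \<le> ?p i l"
      unfolding m(1) by (intro p_exc_even_lower ge1 elim \<open>2 \<notin> E\<close> m(2))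
    moreover have "?w i powr \<Phi> l \<le> real m ^ m * ?p i l"
    proof -
      have "?w i powr \<Phi> l = (2 powr \<Phi> l) ^ m"
        by (simp add: parity_weight_def m powr_powr mult.commute flip: powr_realpow)
      also have "\<dots> \<le> real (f l 2) ^ m"
        using bounds[rule_format, OF elim, of 2] by (intro power_mono) auto
      also have "\<dots> \<le> real m ^ m * ?p i l"
        using le m by (simp add: power_divide field_simps)
      finally show ?thesis .
    qed
    ultimately show ?case by (simp add: m_def)
  qed
  have p_bigomega: "(\<lambda>l. ?w i powr \<Phi> l) \<in> O(?p i)" if "even i" "i > 0" for i
  proof (rule bigoI[of _ "real (i div 2) ^ (i div 2)"])
    show "\<forall>\<^sub>F l in sequentially. norm (?w i powr \<Phi> l) \<le> real (i div 2) ^ (i div 2) * norm (?p i l)"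
      using p_lower[OF that] by eventually_elim auto
  qed

  show ?thesis
  proof (cases "even n")
    case True
    have "(\<lambda>l. ?p (n - 1) l * ?p (n + 1) l) \<in> O(\<lambda>l. ?w (n - 1) powr \<Phi> l * ?w (n + 1) powr \<Phi> l)"
      by (intro landau_o.big.mult p_bigo)
    also have "(\<lambda>l. ?w (n - 1) powr \<Phi> l * ?w (n + 1) powr \<Phi> l) = (\<lambda>l. (?w (n - 1) * ?w (n + 1)) powr \<Phi> l)"
      by (intro ext powr_mult[symmetric])
    also have "\<dots> \<in> o(\<lambda>l. (?w n ^ 2) powr \<Phi> l)"
      using parity_weight_neighbours(1)[OF _ True] \<open>n \<ge> 5\<close> parity_weight_pos lim
      by (intro powr_smallo_powr) auto
    also have "(\<lambda>l. (?w n ^ 2) powr \<Phi> l) = (\<lambda>l. (?w n powr \<Phi> l) ^ 2)"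
      by (intro ext) (simp add: power2_eq_square powr_mult)
    also have "\<dots> \<in> O(\<lambda>l. ?p n l ^ 2)"
      by (intro bigo_power p_bigomega True) (use \<open>n \<ge> 5\<close> in simp)
    \<comment> \<open>Any constant below 1 would do in place of \<open>1 / 2\<close>; positivity of
      \<open>p_exc E f l n\<close> then makes the inequality strict.\<close>
    finally have "\<forall>\<^sub>F l in sequentially. norm (?p (n - 1) l * ?p (n + 1) l) \<le> 1 / 2 * norm (?p n l ^ 2)"
      by (rule landau_o.smallD) simp
    moreover have "\<forall>\<^sub>F l in sequentially. 0 < ?p n l"
      using p_lower[OF True] \<open>n \<ge> 5\<close> by (auto elim: eventually_mono)
    ultimately show ?thesis
    proof eventually_elim
      case (elim l)
      then have "0 < ?p n l ^ 2" by simp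
      then have "?p (n - 1) l * ?p (n + 1) l < ?p n l ^ 2"
        using elim(1) unfolding real_norm_def by linarith
      then show ?case using True by (simp add: Delta_exc_def)
    qed
  next
    case False
    have ev: "even (n - 1)" "n - 1 > 0" "even (n + 1)" "n + 1 > 0" using False \<open>n \<ge> 5\<close> by auto
    \<comment> \<open>For odd \<open>n\<close> the roles are exchanged: the square is bounded above,
      and the product of the even-index neighbours dominates.\<close>
    have "(\<lambda>l. ?p n l ^ 2) \<in> O(\<lambda>l. (?w n powr \<Phi> l) ^ 2)"
      by (intro bigo_power p_bigo)
    also have "(\<lambda>l. (?w n powr \<Phi> l) ^ 2) = (\<lambda>l. (?w n ^ 2) powr \<Phi> l)"
      by (intro ext) (simp add: power2_eq_square powr_mult)
    also have "\<dots> \<in> o(\<lambda>l. (?w (n - 1) * ?w (n + 1)) powr \<Phi> l)"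
      using parity_weight_neighbours(2)[OF _ False] \<open>n \<ge> 5\<close> lim
      by (intro powr_smallo_powr zero_less_power parity_weight_pos) auto
    also have "(\<lambda>l. (?w (n - 1) * ?w (n + 1)) powr \<Phi> l) = (\<lambda>l. ?w (n - 1) powr \<Phi> l * ?w (n + 1) powr \<Phi> l)"
      by (intro ext powr_mult)
    also have "\<dots> \<in> O(\<lambda>l. ?p (n - 1) l * ?p (n + 1) l)"
      by (intro landau_o.big.mult p_bigomega ev)
    finally have "\<forall>\<^sub>F l in sequentially. norm (?p n l ^ 2) \<le> 1 / 2 * norm (?p (n - 1) l * ?p (n + 1) l)"
      by (rule landau_o.smallD) simp
    with p_lower[OF ev(1,2)] p_lower[OF ev(3,4)] show ?thesis
    proof eventually_elim
      case (elim l)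
      then have "0 < ?p (n - 1) l * ?p (n + 1) l" by simp
      then have "?p n l ^ 2 < ?p (n - 1) l * ?p (n + 1) l"
        using elim(3) unfolding real_norm_def by linarith
      then show ?case using False by (simp add: Delta_exc_def)
    qed
  qed
qed

end
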